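(* Let $0<s<1$, $0<\alpha\le1$, and let $D\subset\mathbb{R}^n$ be an open set, possibly unbounded and disconnected. Assume that there is a constant $c_0>0$ such that for any $x^0\in\mathbb{R}^n$, $$\liminf_{R\to+\infty}\frac{|B_R(x^0)\cap D^c|}{|B_R(x^0)|}\ge c_0.$$ Let $u(x,t)\in(C^2(D)\cap\tilde{\mathcal{L}}_{2s})\times(C^1(\mathbb{R})\cap\mathcal{L}^-_\alpha(\mathbb{R}))$ be bounded from above and satisfy $$\begin{cases}\partial_t^\alpha u(x,t)+(-\Delta)^su(x,t)-\Delta u(x,t)\le0, & \text{at the points in } D\times\mathbb{R} \text{ where } u(x,t)>0,\\ u(x,t)\le0, & \text{in } D^c\times\mathbb{R}.\end{cases}$$ Then $u(x,t)\le0$ for all $(x,t)\in D\times\mathbb{R}$.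
   Context: $D^c=\mathbb{R}^n\setminus D$, $B_R(x)$ is the open ball of radius $R$ centered at $x$, and $|\cdot|$ of a set is Lebesgue measure. For functions $v(x,t)$ on $\mathbb{R}^n\times\mathbb{R}$, the notation $v\in(C^2(D)\cap\tilde{\mathcal{L}}_{2s})\times(C^1(\mathbb{R})\cap\mathcal{L}^-_\alpha(\mathbb{R}))$ means that, as a function of $x$ (for each $t$), $v$ is in the first space, and as a function of $t$ (for each $x$), it is in the second space, where $$\tilde{\mathcal{L}}_{2s}=\Big\{v(\cdot,t)\in L^1_{loc}(\mathbb{R}^n)\ \Big|\ \int_{\mathbb{R}^n}\frac{|v(x,t)|}{1+|x|^{n+2s}}\,dx<+\infty\Big\},$$ $$\mathcal{L}^-_\alpha(\mathbb{R})=\Big\{v\in L^1_{loc}(\mathbb{R})\ \Big|\ \int_{-\infty}^t\frac{|v(\tau)|}{1+|\tau|^{1+\alpha}}\,d\tau<+\infty\ \text{for each } t\in\mathbb{R}\Big\}.$$ For $0<\alpha<1$, $\partial_t^\alpha$ is the Marchaud fractional derivative $$\partial_t^\alpha v(x,t)=C_\alpha\int_{-\infty}^t\frac{v(x,t)-v(x,\tau)}{(t-\tau)^{1+\alpha}}\,d\tau,\qquad C_\alpha=\frac{\alpha}{\Gamma(1-\alpha)},$$ and for $\alpha=1$ it is the classical derivative $\partial_t v$. For each fixed $t$, $$(-\Delta)^s v(x,t)=C_{n,s}\,\mathrm{P.V.}\int_{\mathbb{R}^n}\frac{v(x,t)-v(y,t)}{|x-y|^{n+2s}}\,dy=C_{n,s}\lim_{\epsilon\to0}\int_{\mathbb{R}^n\setminus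 B_\epsilon(x)}\frac{v(x,t)-v(y,t)}{|x-y|^{n+2s}}\,dy,$$ with $C_{n,s}>0$ the usual normalization constant, and $\Delta$ is the classical Laplacian in $x$.
   Formalization: Added hypothesis: u is upper semicontinuous jointly in (x,t) on the closure of D times R. Without it the claim fails: u may jump down across the boundary of D, e.g. u=2-(1-(x/r)^2)^p on D=(-r,r), 0 outside, with r small, 0<p<1, p≤2-2s. *)

theory Defs
  imports "HOL-Analysis.Analysis"
begin

definition locally_L1 :: "('a::euclidean_space \<Rightarrow> real) \<Rightarrow> bool" where
  "locally_L1 v \<longleftrightarrow> (\<forall>K. compact K \<longrightarrow> set_integrable lebesgue K v)"

definition Ltilde :: "real \<Rightarrow> ('a::euclidean_space \<Rightarrow> real) set" where
  "Ltilde s = {v. locally_L1 v \<and>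
     integrable lebesgue (\<lambda>x. \<bar>v x\<bar> / (1 + norm x powr (real DIM('a) + 2 * s)))}"

definition Lminus :: "real \<Rightarrow> (real \<Rightarrow> real) set" where
  "Lminus \<alpha> = {v. locally_L1 v \<and>
     (\<forall>t. set_integrable lebesgue {..t} (\<lambda>\<tau>. \<bar>v \<tau>\<bar> / (1 + \<bar>\<tau>\<bar> powr (1 + \<alpha>))))}"

text \<open>Twice continuously (Frechet) differentiable; meant for open \<open>D\<close>.\<close>

definition C2_on :: "'a::euclidean_space set \<Rightarrow> ('a \<Rightarrow> real) \<Rightarrow> bool" where
  "C2_on D f \<longleftrightarrow>
     (\<exists>(f' :: 'a \<Rightarrow> 'a \<Rightarrow>\<^sub>L real) (f'' :: 'a \<Rightarrow> 'a \<Rightarrow>\<^sub>L ('a \<Rightarrow>\<^sub>L real)).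
        (\<forall>x\<in>D. (f has_derivative blinfun_apply (f' x)) (at x) \<and>
                (f' has_derivative blinfun_apply (f'' x)) (at x)) \<and>
        continuous_on D f'')"

text \<open>Regularity of \<open>u\<close> inside \<open>D\<close> alone does not exclude a downward jump across the boundary of
  \<open>D\<close>, and the maximum principle fails for bounded solutions with such a jump. It is therefore
  stated for \<open>u\<close> upper semicontinuous up to the boundary, jointly in space and time; this
  assumption is not spelled out in the source.\<close>

definition upper_semicontinuous_on :: "'a::topological_space set \<Rightarrow> ('a \<Rightarrow> real) \<Rightarrow> bool" where
  "upper_semicontinuous_on S f \<longleftrightarrow>
     (\<forall>p\<in>S. \<forall>c>f p. \<forall>\<^sub>F q in at p within S. f q < c)"

text \<open>The Marchaud derivative for \<open>0 < \<alpha> < 1\<close>, the classical derivative for \<open>\<alpha> = 1\<close>.\<close>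

definition time_deriv :: "real \<Rightarrow> (real \<Rightarrow> real) \<Rightarrow> real \<Rightarrow> real" where
  "time_deriv \<alpha> v t =
     (if \<alpha> = 1 then deriv v t
      else \<alpha> / Gamma (1 - \<alpha>) *
             (LINT \<tau>:{..<t}|lebesgue. (v t - v \<tau>) / (t - \<tau>) powr (1 + \<alpha>)))"

text \<open>The usual constant: it makes \<open>(-\<Delta>)\<^sup>s\<close> the Fourier multiplier \<open>\<bar>\<xi>\<bar>\<^sup>2\<^sup>s\<close>.\<close>

definition frac_laplacian_const :: "nat \<Rightarrow> real \<Rightarrow> real" where
  "frac_laplacian_const n s =
     4 powr s * Gamma (real n / 2 + s) / (pi powr (real n / 2) * \<bar>Gamma (- s)\<bar>)"

definition frac_laplacian :: "real \<Rightarrow> ('a::euclidean_space \<Rightarrow> real) \<Rightarrow> 'a \<Rightarrow> real" where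
  "frac_laplacian s v x = frac_laplacian_const DIM('a) s *
     Lim (at_right 0) (\<lambda>\<epsilon>. LINT y:- ball x \<epsilon>|lebesgue.
        (v x - v y) / norm (x - y) powr (real DIM('a) + 2 * s))"

definition laplacian :: "('a::euclidean_space \<Rightarrow> real) \<Rightarrow> 'a \<Rightarrow> real" where
  "laplacian v x = (\<Sum>b\<in>Basis. (deriv ^^ 2) (\<lambda>h. v (x + h *\<^sub>R b)) 0)"

end

theory Submission
  imports Defs
begin

text \<open>
  The proof is by contradiction, by perturbing an almost maximum point. Suppose \<open>M = sup u > 0\<close> and
  let \<open>m = \<epsilon> M\<close> with a small \<open>\<epsilon>\<close>. Near a point \<open>(x\<^sub>0, t\<^sub>0)\<close> with \<open>u > M - m\<close>, subtract from \<open>u\<close> the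
  paraboloid \<open>m (\<bar>x - x\<^sub>0\<bar>\<^sup>2 / R\<^sup>2 + (t - t\<^sub>0)\<^sup>2 / T\<^sup>2)\<close>. The difference is at most \<open>M - m\<close> outside the
  cylinder of radius \<open>R\<close> and half-length \<open>T\<close>, so it attains its maximum over all of space-time at a
  point \<open>(x, t)\<close> inside the cylinder (lemma \<open>penalized_maximum\<close>; this is where upper semicontinuity
  enters). There \<open>u (x, t) > M - m > 0\<close>, so \<open>x\<close> lies in \<open>D\<close> and the differential inequality holds.

  Each of its terms is estimated at \<open>(x, t)\<close>, using that \<open>u\<close> is touched from above by a paraboloid
  there and nowhere exceeds \<open>u (x, t)\<close> by more than \<open>m\<close>:
  \<^item> \<open>\<Delta> u \<le> 2 n m / R\<^sup>2\<close> (\<open>laplacian_touching\<close>);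
  \<^item> the time derivative is at least \<open>- C m T\<^sup>-\<^sup>\<alpha>\<close> (\<open>time_deriv_touching\<close>), and \<open>T\<close> is free, so this is
    made equal to \<open>- m R\<^sup>-\<^sup>2\<^sup>s\<close>;
  \<^item> the fractional Laplacian is at least \<open>c M R\<^sup>-\<^sup>2\<^sup>s - C m R\<^sup>-\<^sup>2\<^sup>s\<close> (\<open>frac_laplacian_touching\<close>). The
    gain \<open>c M R\<^sup>-\<^sup>2\<^sup>s\<close> comes from the complement of \<open>D\<close>: there \<open>u \<le> 0\<close> is lower than \<open>u (x, t)\<close> by
    almost \<open>M\<close>, and the complement fills a fixed fraction of the ball \<open>B\<^sub>R (x\<^sub>0)\<close> once \<open>R\<close> is large.

  For \<open>R \<ge> 1\<close> every error is \<open>O(\<epsilon> M R\<^sup>-\<^sup>2\<^sup>s)\<close>, with constants that depend neither on \<open>R\<close> nor on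
  \<open>(x\<^sub>0, t\<^sub>0)\<close>. Hence \<open>\<epsilon>\<close> can be fixed first, then \<open>(x\<^sub>0, t\<^sub>0)\<close>, and only then the \<open>R\<close> for which the
  density assumption at \<open>x\<^sub>0\<close> is effective; for small \<open>\<epsilon>\<close> the left-hand side is positive, a
  contradiction.

  The singular integrals are all controlled by one kernel, \<open>min 1 (\<bar>z\<bar> / R)\<^sup>\<kappa> / \<bar>z\<bar>\<^bsup>n + \<beta>\<^esup>\<close>, whose integral
  scales like \<open>R\<^sup>-\<^sup>\<beta>\<close>. The principal value becomes an absolutely convergent integral when the odd
  first-order term is added on a ball (\<open>frac_laplacian_corrected\<close>).
\<close>

section \<open>The truncated Riesz kernel\<close>

lemma dyadic_shell_ge_1:
  fixes r :: real assumes "1 \<le> r"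
  obtains k :: nat where "2 ^ k \<le> r" "r < 2 ^ Suc k"
proof -
  define m where "m = (LEAST m::nat. r < 2 ^ m)"
  have ex: "\<exists>m::nat. r < 2 ^ m"
    using real_arch_pow[of 2 r] by auto
  have m: "r < 2 ^ m" unfolding m_def using ex by (rule LeastI_ex)
  have "m \<noteq> 0" using m assms by (cases m) auto
  then obtain k where k: "m = Suc k" by (cases m) auto
  have "\<not> r < 2 ^ k" using not_less_Least[of k "\<lambda>m. r < 2 ^ m"] k by (simp add: m_def)
  then show ?thesis using that[of k] m k by simp
qed

text \<open>
  The truncation makes the kernel behave like \<open>\<bar>z\<bar>\<^bsup>\<kappa> - \<beta> - n\<^esup>\<close> near \<open>0\<close> and like \<open>\<bar>z\<bar>\<^bsup>- \<beta> - n\<^esup>\<close> near infinity,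
  and both are integrable because \<open>0 < \<beta> < \<kappa>\<close>. The shell of radius about \<open>2\<^sup>k R\<close> contributes at most
  \<open>R\<^sup>-\<^sup>\<beta>\<close> times the \<open>k\<close>-th term of a geometric series, separately for \<open>k \<ge> 0\<close> and \<open>k < 0\<close>, which yields
  the scaling in \<open>R\<close> without any change of variables.
\<close>

lemma truncated_riesz_kernel_bound:
  fixes \<beta> \<kappa> :: real
  assumes "0 < \<beta>" "\<beta> < \<kappa>"
  obtains C where "0 < C"
    "\<And>(x::'a::euclidean_space) R. 0 < R \<Longrightarrow>
       integrable lebesgue (\<lambda>y. min 1 ((norm (x - y) / R) powr \<kappa>) / norm (x - y) powr (real DIM('a) + \<beta>))"
    "\<And>(x::'a::euclidean_space) R. 0 < R \<Longrightarrow>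
       (LINT y|lebesgue. min 1 ((norm (x - y) / R) powr \<kappa>) / norm (x - y) powr (real DIM('a) + \<beta>))
         \<le> C * R powr (- \<beta>)"
proof -
  define d where "d = real DIM('a)"
  define w where "w = unit_ball_vol d"
  have d: "0 < d" and w: "0 < w" by (auto simp: d_def w_def)
  define p1 where "p1 = 2 powr (- \<beta>)"
  define p2 where "p2 = 2 powr (- (\<kappa> - \<beta>))"
  have p1: "0 < p1" "p1 < 1" and p2: "0 < p2" "p2 < 1"
    using assms by (auto simp: p1_def p2_def powr_less_one)
  define C where "C = w * (2 powr d / (1 - p1) + 2 powr (d + \<beta>) / (1 - p2))"
  have C: "0 < C" unfolding C_def using p1 p2 w by (intro mult_pos_pos add_pos_pos divide_pos_pos) auto
  have main: "(\<integral>\<^sup>+y. ennreal (min 1 ((norm (x - y) / R) powr \<kappa>) / norm (x - y) powr (d + \<beta>)) \<partial>lebesgue)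
       \<le> ennreal (C * R powr (- \<beta>))" if R: "0 < R" for x :: 'a and R
  proof -
    \<comment> \<open>The height \<open>a k\<close> on the ball \<open>U k\<close> dominates the kernel on the outer shell
      \<open>2\<^sup>k \<le> \<bar>z\<bar> / R < 2\<^bsup>k + 1\<^esup>\<close>, and \<open>b k\<close> on \<open>V k\<close> dominates it on the inner shell
      \<open>2\<^bsup>- k - 1\<^esup> < \<bar>z\<bar> / R \<le> 2\<^bsup>- k\<^esup>\<close>. The overlap of the balls is harmless.\<close>
    define a where "a = (\<lambda>k::nat. R powr (- (d + \<beta>)) * (2 ^ k) powr (- (d + \<beta>)))"
    define b where "b = (\<lambda>k::nat. R powr (- (d + \<beta>)) * ((2 ^ k) powr (- \<kappa>) * (2 ^ Suc k) powr (d + \<beta>)))"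
    define U where "U = (\<lambda>k::nat. cball x (2 ^ Suc k * R))"
    define V where "V = (\<lambda>k::nat. cball x (R / 2 ^ k))"
    have [measurable]: "U k \<in> sets lebesgue" "V k \<in> sets lebesgue" for k
      by (auto simp: U_def V_def)
    have ab: "0 \<le> a k" "0 \<le> b k" for k by (auto simp: a_def b_def)
    let ?f = "\<lambda>y. min 1 ((norm (x - y) / R) powr \<kappa>) / norm (x - y) powr (d + \<beta>)"
    let ?g = "\<lambda>k y. ennreal (a k) * indicator (U k) y + ennreal (b k) * indicator (V k) y"
    have pw: "ennreal (?f y) \<le> (\<Sum>k. ?g k y)" for y
    proof -
      define r where "r = norm (x - y) / R"
      have r0: "0 \<le> r" using R by (simp add: r_def)
      have n: "norm (x - y) = R * r" using R by (simp add: r_def)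
      have f_eq: "?f y = R powr (- (d + \<beta>)) * (min 1 (r powr \<kappa>) * r powr (- (d + \<beta>)))"
        unfolding n powr_minus_divide using R r0 by (simp add: powr_mult)
      have single: "?g k y \<le> (\<Sum>k. ?g k y)" for k
        using sum_le_suminf[of "\<lambda>k. ?g k y" "{k}"] by (simp add: summableI)
      consider "r = 0" | "0 < r" "r < 1" | "1 \<le> r" using r0 by linarith
      then show ?thesis
      proof cases
        case 1 then show ?thesis using assms by (simp add: f_eq)
      next
        case 3
        obtain k where k: "2 ^ k \<le> r" "r < 2 ^ Suc k" using dyadic_shell_ge_1[OF 3] .
        have "r powr (- (d + \<beta>)) \<le> (2 ^ k) powr (- (d + \<beta>))"
          using k d assms by (intro powr_mono2') auto
        then have "min 1 (r powr \<kappa>) * r powr (- (d + \<beta>)) \<le> 1 * (2 ^ k) powr (- (d + \<beta>))"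
          by (intro mult_mono) auto
        then have "?f y \<le> a k" unfolding f_eq a_def by (intro mult_left_mono) auto
        moreover have "y \<in> U k" using k R by (simp add: U_def dist_norm n mult.commute)
        ultimately have "ennreal (?f y) \<le> ?g k y" by (simp add: ennreal_leI add_increasing2)
        then show ?thesis using single[of k] by (rule order_trans)
      next
        case 2
        then have "1 \<le> 1 / r" by simp
        then obtain k where k: "2 ^ k \<le> 1 / r" "1 / r < 2 ^ Suc k" using dyadic_shell_ge_1 by blast
        have k': "r \<le> 1 / 2 ^ k" "1 / 2 ^ Suc k \<le> r"
          using k 2 by (simp_all add: field_simps)
        have "r powr \<kappa> \<le> (1 / 2 ^ k) powr \<kappa>" using k' 2 assms by (intro powr_mono2) auto
        also have "\<dots> = (2 ^ k) powr (- \<kappa>)" by (simp add: powr_divide powr_minus_divide)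
        finally have e1: "r powr \<kappa> \<le> (2 ^ k) powr (- \<kappa>)" .
        have "r powr (- (d + \<beta>)) \<le> (1 / 2 ^ Suc k) powr (- (d + \<beta>))"
          using k' d assms by (intro powr_mono2') auto
        also have "\<dots> = (2 ^ Suc k) powr (d + \<beta>)" unfolding powr_minus_divide by (simp add: powr_divide del: power_Suc)
        finally have e2: "r powr (- (d + \<beta>)) \<le> (2 ^ Suc k) powr (d + \<beta>)" .
        have "min 1 (r powr \<kappa>) * r powr (- (d + \<beta>)) \<le> (2 ^ k) powr (- \<kappa>) * (2 ^ Suc k) powr (d + \<beta>)"
          using e1 e2 by (intro mult_mono) auto
        then have "?f y \<le> b k" unfolding f_eq b_def by (intro mult_left_mono) auto
        moreover have "y \<in> V k" using k' R by (simp add: V_def dist_norm n field_simps)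
        ultimately have "ennreal (?f y) \<le> ?g k y" by (simp add: ennreal_leI add_increasing)
        then show ?thesis using single[of k] by (rule order_trans)
      qed
    qed
    have vol: "emeasure lebesgue (cball x r) = ennreal (w * r powr d)" if "0 < r" for r
      using that emeasure_cball[of r x] by (simp add: w_def d_def powr_realpow)
    have two: "(2 ^ k) powr c = (2 powr c) ^ k" for k :: nat and c :: real
      by (simp add: powr_realpow[symmetric] powr_powr mult.commute)
    have ga: "a k * (w * (2 ^ Suc k * R) powr d) = w * R powr (- \<beta>) * 2 powr d * p1 ^ k" for k
    proof -
      have "a k * (w * (2 ^ Suc k * R) powr d)
          = w * (R powr (- (d + \<beta>)) * R powr d) * 2 powr d * ((2 ^ k) powr (- (d + \<beta>)) * (2 ^ k) powr d)"
        using R by (simp add: a_def powr_mult)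
      also have "\<dots> = w * R powr (- \<beta>) * 2 powr d * p1 ^ k"
        by (simp only: powr_add[symmetric]) (simp add: two p1_def)
      finally show ?thesis .
    qed
    have gb: "b k * (w * (R / 2 ^ k) powr d) = w * R powr (- \<beta>) * 2 powr (d + \<beta>) * p2 ^ k" for k
    proof -
      have "b k * (w * (R / 2 ^ k) powr d)
          = w * (R powr (- (d + \<beta>)) * R powr d) * 2 powr (d + \<beta>)
              * ((2 ^ k) powr (- \<kappa>) * (2 ^ k) powr (d + \<beta>) * (2 ^ k) powr (- d))"
        using R by (simp add: b_def powr_mult powr_divide powr_minus_divide)
      also have "\<dots> = w * R powr (- \<beta>) * 2 powr (d + \<beta>) * p2 ^ k"
        by (simp only: powr_add[symmetric]) (simp add: two p2_def)
      finally show ?thesis .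
    qed
    let ?c = "\<lambda>k. w * R powr (- \<beta>) * 2 powr d * p1 ^ k + w * R powr (- \<beta>) * 2 powr (d + \<beta>) * p2 ^ k"
    have term_int: "(\<integral>\<^sup>+y. ?g k y \<partial>lebesgue) = ennreal (?c k)" for k
    proof -
      have "(\<integral>\<^sup>+y. ?g k y \<partial>lebesgue)
          = ennreal (a k) * emeasure lebesgue (U k) + ennreal (b k) * emeasure lebesgue (V k)"
        by (subst nn_integral_add) (auto simp: nn_integral_cmult_indicator)
      also have "\<dots> = ennreal (a k * (w * (2 ^ Suc k * R) powr d)) + ennreal (b k * (w * (R / 2 ^ k) powr d))"
        unfolding U_def V_def using R ab by (subst (1 2) vol) (auto simp: ennreal_mult' )
      also have "\<dots> = ennreal (?c k)"
        unfolding ga gb using w p1 p2 by (subst ennreal_plus) auto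
      finally show ?thesis .
    qed
    have sums: "?c sums (w * R powr (- \<beta>) * 2 powr d * (1 / (1 - p1))
        + w * R powr (- \<beta>) * 2 powr (d + \<beta>) * (1 / (1 - p2)))"
      using p1 p2 by (intro sums_add sums_mult geometric_sums) auto
    have "(\<integral>\<^sup>+y. ennreal (?f y) \<partial>lebesgue) \<le> (\<integral>\<^sup>+y. (\<Sum>k. ?g k y) \<partial>lebesgue)"
      by (intro nn_integral_mono pw)
    also have "\<dots> = (\<Sum>k. \<integral>\<^sup>+y. ?g k y \<partial>lebesgue)"
      by (rule nn_integral_suminf) auto
    also have "\<dots> = ennreal (\<Sum>k. ?c k)"
      unfolding term_int using w p1 p2 sums
      by (intro suminf_ennreal2) (auto simp: sums_iff)
    also have "(\<Sum>k. ?c k) = C * R powr (- \<beta>)"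
      using sums by (simp add: sums_iff C_def algebra_simps)
    finally show ?thesis .
  qed
  have meas: "(\<lambda>y::'a. min 1 ((norm (x - y) / R) powr \<kappa>) / norm (x - y) powr (d + \<beta>)) \<in> borel_measurable lebesgue"
    for x R by (intro measurable_completion) measurable
  show ?thesis
  proof (rule that[OF C])
    fix x :: 'a and R :: real assume R: "0 < R"
    show "integrable lebesgue (\<lambda>y. min 1 ((norm (x - y) / R) powr \<kappa>) / norm (x - y) powr (real DIM('a) + \<beta>))"
    proof (rule integrableI_bounded)
      show "(\<integral>\<^sup>+y. ennreal (norm (min 1 ((norm (x - y) / R) powr \<kappa>) / norm (x - y) powr (real DIM('a) + \<beta>))) \<partial>lebesgue) < \<infinity>"
        using main[OF R, of x] by (simp add: d_def order_le_less_trans)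
    qed (use meas in \<open>simp add: d_def\<close>)
    show "(LINT y|lebesgue. min 1 ((norm (x - y) / R) powr \<kappa>) / norm (x - y) powr (real DIM('a) + \<beta>))
         \<le> C * R powr (- \<beta>)"
      using main[OF R, of x] C by (intro integral_real_bounded) (auto simp: d_def)
  qed
qed

section \<open>The fractional Laplacian as an absolutely convergent integral\<close>

lemma lebesgue_integral_reflect:
  fixes h :: "'a::euclidean_space \<Rightarrow> real"
  assumes [measurable]: "h \<in> borel_measurable borel"
  shows "(LINT y|lebesgue. h (2 *\<^sub>R x - y)) = (LINT y|lebesgue. h y)"
proof -
  have "lborel = density (distr lborel borel (\<lambda>y::'a. 2 *\<^sub>R x + (-1) *\<^sub>R y)) (\<lambda>_. \<bar>- 1 :: real\<bar> ^ DIM('a))"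
    by (rule lborel_affine) simp
  also have "\<dots> = distr lborel borel (\<lambda>y. 2 *\<^sub>R x - y)" by (simp add: density_1)
  finally have eq: "distr lborel borel (\<lambda>y. 2 *\<^sub>R x - y) = lborel" by simp
  have "(LINT y|lborel. h (2 *\<^sub>R x - y)) = (LINT y|distr lborel borel (\<lambda>y. 2 *\<^sub>R x - y). h y)"
    by (subst integral_distr) auto
  then show ?thesis by (simp add: eq integral_completion)
qed

lemma locally_L1_measurable:
  assumes "locally_L1 v"
  shows "v \<in> borel_measurable lebesgue"
proof (rule borel_measurable_LIMSEQ_real)
  fix k :: nat
  show "(\<lambda>x. indicator (cball 0 (real k)) x * v x) \<in> borel_measurable lebesgue"
  proof -
    have "set_integrable lebesgue (cball 0 (real k)) v"
      using assms compact_cball unfolding locally_L1_def by blast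
    then show ?thesis unfolding set_integrable_def by (simp add: borel_measurable_integrable)
  qed
next
  fix x :: 'a
  have "\<forall>\<^sub>F k in sequentially. real k \<ge> norm x"
    using filterlim_real_sequentially by (simp add: filterlim_at_top)
  then have "\<forall>\<^sub>F k in sequentially. indicator (cball 0 (real k)) x * v x = v x"
    by eventually_elim (simp add: dist_norm)
  then show "(\<lambda>k. indicator (cball 0 (real k)) x * v x) \<longlonglongrightarrow> v x"
    by (rule tendsto_eventually)
qed

text \<open>
  At a point with a quadratic Taylor bound, adding the first-order term \<open>p \<bullet> (y - x)\<close> on a ball makes
  the integrand \<open>O(\<bar>y - x\<bar>\<^bsup>2 - n - 2 s\<^esup>)\<close>, hence absolutely integrable. On the complement of a small ball
  the added term is odd about \<open>x\<close> and integrates to \<open>0\<close>. So the truncated integrals are those of a fixed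
  integrable function, and dominated convergence identifies the principal value. The radius \<open>R\<close> is
  arbitrary, and taking it to be the scale of the paraboloid later gives estimates with the right
  power of \<open>R\<close>.
\<close>

lemma
  fixes v :: "'a::euclidean_space \<Rightarrow> real"
  assumes s: "0 < s" "s < 1" and v: "v \<in> Ltilde s"
    and \<delta>: "0 < \<delta>" and R: "0 < R"
    and taylor: "\<And>y. norm (y - x) < \<delta> \<Longrightarrow> \<bar>v y - v x - p \<bullet> (y - x)\<bar> \<le> K * (norm (y - x))\<^sup>2"
  shows corrected_integrand_integrable:
      "integrable lebesgue (\<lambda>y. (v x - v y + indicator (ball x R) y * (p \<bullet> (y - x)))
         / norm (x - y) powr (real DIM('a) + 2 * s))" (is "integrable _ ?F")
    and frac_laplacian_corrected:
      "frac_laplacian s v x = frac_laplacian_const DIM('a) s *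
         (LINT y|lebesgue. (v x - v y + indicator (ball x R) y * (p \<bullet> (y - x)))
            / norm (x - y) powr (real DIM('a) + 2 * s))"
proof -
  define q where "q = real DIM('a) + 2 * s"
  have q: "0 < q" using s by (simp add: q_def)
  have kernel: "integrable lebesgue (\<lambda>y. min 1 ((norm (z - y) / r) powr 2) / norm (z - y) powr q)"
    if "0 < r" for z :: 'a and r
    by (rule truncated_riesz_kernel_bound[of "2 * s" 2]) (use s that in \<open>auto simp: q_def\<close>)
  have [measurable]: "v \<in> borel_measurable lebesgue"
    using v by (intro locally_L1_measurable) (simp add: Ltilde_def)
  have weight: "(\<lambda>y. norm (x - y) powr q) \<in> borel_measurable borel"
    "(\<lambda>y. p \<bullet> (y - x)) \<in> borel_measurable borel"
    by measurable
  then have [measurable]: "(\<lambda>y. norm (x - y) powr q) \<in> borel_measurable lebesgue"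
    "(\<lambda>y. p \<bullet> (y - x)) \<in> borel_measurable lebesgue"
    by (auto intro: measurable_completion)
  have [measurable]: "ball x r \<in> sets lebesgue" "- ball x r \<in> sets lebesgue" for r by auto
  have tail: "integrable lebesgue (\<lambda>y. \<bar>v y\<bar> / (1 + norm y powr q))"
    using v by (simp add: Ltilde_def q_def)
  define \<eta> where "\<eta> = min \<delta> R"
  have \<eta>: "0 < \<eta>" "\<eta> \<le> \<delta>" "\<eta> \<le> R" using \<delta> R by (auto simp: \<eta>_def)
  \<comment> \<open>\<open>B\<close> is the constant in \<open>1 + \<bar>y\<bar>\<^sup>q \<le> B \<bar>x - y\<bar>\<^sup>q\<close>, valid for \<open>\<bar>x - y\<bar> \<ge> \<eta>\<close>.\<close>
  define A where "A = \<bar>K\<bar> * \<eta>\<^sup>2 + \<bar>v x\<bar> + norm p * R"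
  define B where "B = \<eta> powr (- q) + (norm x / \<eta> + 1) powr q"
  have A: "\<bar>K\<bar> * \<eta>\<^sup>2 \<le> A" "\<bar>v x\<bar> + norm p * R \<le> A" using R by (auto simp: A_def)
  have B: "0 \<le> B" by (simp add: B_def)
  let ?k = "\<lambda>r y. min 1 ((norm (x - y) / r) powr 2) / norm (x - y) powr q"
  have F_bound: "norm (?F y) \<le> A * ?k \<eta> y + B * (\<bar>v y\<bar> / (1 + norm y powr q))" for y
  proof (cases "norm (x - y) < \<eta>")
    case True
    then have y: "norm (y - x) < \<delta>" "y \<in> ball x R" using \<eta> by (auto simp: dist_norm norm_minus_commute)
    have "min 1 ((norm (x - y) / \<eta>) powr 2) = (norm (x - y) / \<eta>) powr 2"
      using True \<eta> by (intro min_absorb2) (simp add: power_le_one)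
    also have "\<dots> = (norm (y - x))\<^sup>2 / \<eta>\<^sup>2"
      using \<eta> by (simp add: power_divide norm_minus_commute)
    finally have k: "\<bar>K\<bar> * \<eta>\<^sup>2 * min 1 ((norm (x - y) / \<eta>) powr 2) = \<bar>K\<bar> * (norm (y - x))\<^sup>2"
      using \<eta> by simp
    have "\<bar>v x - v y + p \<bullet> (y - x)\<bar> \<le> K * (norm (y - x))\<^sup>2"
      using taylor[OF y(1)] by linarith
    also have "\<dots> \<le> \<bar>K\<bar> * (norm (y - x))\<^sup>2" by (intro mult_right_mono) auto
    also have "\<dots> \<le> A * min 1 ((norm (x - y) / \<eta>) powr 2)"
      unfolding k[symmetric] using A by (intro mult_right_mono) auto
    finally have "norm (?F y) \<le> A * ?k \<eta> y"
      using y(2) by (simp add: q_def divide_right_mono abs_divide)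
    moreover have "0 \<le> B * (\<bar>v y\<bar> / (1 + norm y powr q))" using B by simp
    ultimately show ?thesis by linarith
  next
    case False
    define r where "r = norm (x - y)"
    have r: "\<eta> \<le> r" "0 < r" using False \<eta> by (auto simp: r_def)
    have "1 \<le> (r / \<eta>)\<^sup>2" using r \<eta> by (intro one_le_power) simp
    then have k1: "?k \<eta> y = 1 / r powr q" using r \<eta> by (simp add: r_def)
    have "\<bar>indicator (ball x R) y * (p \<bullet> (y - x))\<bar> \<le> norm p * R"
    proof (cases "y \<in> ball x R")
      case True
      have "\<bar>p \<bullet> (y - x)\<bar> \<le> norm p * norm (y - x)" by (rule Cauchy_Schwarz_ineq2)
      also have "\<dots> \<le> norm p * R" using True by (intro mult_left_mono) (auto simp: dist_norm norm_minus_commute)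
      finally show ?thesis using True by simp
    qed (use R in simp)
    then have "\<bar>v x - v y + indicator (ball x R) y * (p \<bullet> (y - x))\<bar> \<le> A + \<bar>v y\<bar>" using A by linarith
    then have "norm (?F y) \<le> (A + \<bar>v y\<bar>) / r powr q"
      by (simp add: q_def r_def divide_right_mono abs_divide)
    also have "\<dots> = A * ?k \<eta> y + \<bar>v y\<bar> / r powr q" unfolding k1 by (simp add: add_divide_distrib)
    also have "\<bar>v y\<bar> / r powr q \<le> B * (\<bar>v y\<bar> / (1 + norm y powr q))"
    proof -
      have "norm y \<le> norm x + r" unfolding r_def using norm_triangle_ineq[of x "y - x"] by (simp add: norm_minus_commute)
      also have "norm x \<le> norm x / \<eta> * r" using r \<eta> by (simp add: field_simps mult_right_mono)
      finally have "norm y \<le> (norm x / \<eta> + 1) * r" by (simp add: algebra_simps)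
      then have "norm y powr q \<le> ((norm x / \<eta> + 1) * r) powr q" using q by (intro powr_mono2) auto
      also have "\<dots> = (norm x / \<eta> + 1) powr q * r powr q" using \<eta> r by (intro powr_mult)
      finally have 1: "norm y powr q \<le> (norm x / \<eta> + 1) powr q * r powr q" .
      have "\<eta> powr q \<le> r powr q" using r \<eta> q by (intro powr_mono2) auto
      then have "1 \<le> \<eta> powr (- q) * r powr q" using \<eta> by (simp add: powr_minus field_simps)
      with 1 have "1 + norm y powr q \<le> B * r powr q" by (simp add: B_def algebra_simps)
      then have "\<bar>v y\<bar> * (1 + norm y powr q) \<le> \<bar>v y\<bar> * (B * r powr q)" by (intro mult_left_mono) auto
      moreover have "0 < 1 + norm y powr q" by (simp add: add_pos_nonneg)
      ultimately show ?thesis using r by (simp add: divide_le_eq le_divide_eq) (simp add: field_simps)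
    qed
    finally show ?thesis by simp
  qed
  have [measurable]: "?F \<in> borel_measurable lebesgue" unfolding q_def[symmetric] by measurable
  show F: "integrable lebesgue ?F"
  proof (rule Bochner_Integration.integrable_bound)
    show "integrable lebesgue (\<lambda>y. A * ?k \<eta> y + B * (\<bar>v y\<bar> / (1 + norm y powr q)))"
      using kernel[OF \<eta>(1)] tail by (intro Bochner_Integration.integrable_add integrable_mult_right)
  next
    show "AE y in lebesgue. norm (?F y) \<le> norm (A * ?k \<eta> y + B * (\<bar>v y\<bar> / (1 + norm y powr q)))"
      unfolding real_norm_def[of "_ + _"] by (intro AE_I2 order_trans[OF F_bound abs_ge_self])
  qed measurable
  \<comment> \<open>The correction \<open>h\<close> vanishes after integration because it changes sign under
    \<open>y \<mapsto> 2 x - y\<close>.\<close>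
  have cut: "(LINT y:- ball x \<epsilon>|lebesgue. (v x - v y) / norm (x - y) powr q)
       = (LINT y|lebesgue. indicator (- ball x \<epsilon>) y * ?F y)" if \<epsilon>: "0 < \<epsilon>" for \<epsilon>
  proof -
    let ?h = "\<lambda>y. indicator (- ball x \<epsilon> \<inter> ball x R) y * (p \<bullet> (y - x)) / norm (x - y) powr q"
    have h_int: "integrable lebesgue ?h"
    proof (rule Bochner_Integration.integrable_bound)
      show "integrable lebesgue (\<lambda>y. norm p * R * ?k \<epsilon> y)"
        using kernel[OF \<epsilon>] by (intro integrable_mult_right)
    next
      have "norm (?h y) \<le> norm p * R * ?k \<epsilon> y" for y
      proof (cases "y \<in> - ball x \<epsilon> \<inter> ball x R")
        case True
        then have "1 \<le> (norm (x - y) / \<epsilon>)\<^sup>2" using \<epsilon> by (intro one_le_power) (simp add: dist_norm)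
        then have k1: "?k \<epsilon> y = 1 / norm (x - y) powr q" using \<epsilon> by simp
        have "\<bar>p \<bullet> (y - x)\<bar> \<le> norm p * norm (y - x)" by (rule Cauchy_Schwarz_ineq2)
        also have "\<dots> \<le> norm p * R" using True by (intro mult_left_mono) (auto simp: dist_norm norm_minus_commute)
        finally show ?thesis unfolding k1 using True by (simp add: divide_right_mono abs_divide)
      qed (use R in \<open>auto simp: indicator_def\<close>)
      then show "AE y in lebesgue. norm (?h y) \<le> norm (norm p * R * ?k \<epsilon> y)"
        unfolding real_norm_def[of "_ * ?k _ _"] by (intro AE_I2 order_trans[OF _ abs_ge_self])
    qed measurable
    have "(LINT y|lebesgue. ?h y) = (LINT y|lebesgue. ?h (2 *\<^sub>R x - y))"
      using weight
      by (intro lebesgue_integral_reflect[symmetric] borel_measurable_divide borel_measurable_times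
            borel_measurable_indicator) auto
    also have "(\<lambda>y. ?h (2 *\<^sub>R x - y)) = (\<lambda>y. - ?h y)"
    proof
      fix y
      have *: "2 *\<^sub>R x - y - x = - (y - x)" "x - (2 *\<^sub>R x - y) = - (x - y)" by (simp_all add: scaleR_2)
      have "indicator (- ball x \<epsilon> \<inter> ball x R) (2 *\<^sub>R x - y) = (indicator (- ball x \<epsilon> \<inter> ball x R) y :: real)"
        by (simp add: indicator_def dist_norm *(2) norm_minus_commute)
      then show "?h (2 *\<^sub>R x - y) = - ?h y"
        by (simp only: * norm_minus_cancel inner_minus_right mult_minus_right minus_divide_left)
    qed
    finally have h0: "(LINT y|lebesgue. ?h y) = 0" by simp
    have "(LINT y:- ball x \<epsilon>|lebesgue. (v x - v y) / norm (x - y) powr q)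
        = (LINT y|lebesgue. indicator (- ball x \<epsilon>) y * ?F y - ?h y)"
      unfolding set_lebesgue_integral_def q_def
      by (intro Bochner_Integration.integral_cong) (auto simp: indicator_def diff_divide_distrib add_divide_distrib)
    also have "\<dots> = (LINT y|lebesgue. indicator (- ball x \<epsilon>) y * ?F y) - (LINT y|lebesgue. ?h y)"
      using integrable_mult_indicator[OF _ F, of "- ball x \<epsilon>"] h_int
      by (intro Bochner_Integration.integral_diff) auto
    finally show ?thesis using h0 by simp
  qed
  have "((\<lambda>\<epsilon>. LINT y|lebesgue. indicator (- ball x \<epsilon>) y * ?F y) \<longlongrightarrow> (LINT y|lebesgue. ?F y)) (at_right 0)"
    unfolding tendsto_at_iff_sequentially comp_def
  proof (intro allI impI)
    fix X :: "nat \<Rightarrow> real" assume X: "\<forall>i. X i \<in> {0<..} - {0}" "X \<longlonglongrightarrow> 0"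
    show "(\<lambda>i. LINT y|lebesgue. indicator (- ball x (X i)) y * ?F y) \<longlonglongrightarrow> (LINT y|lebesgue. ?F y)"
    proof (rule integral_dominated_convergence[where w = "\<lambda>y. norm (?F y)"])
      show "AE y in lebesgue. (\<lambda>i. indicator (- ball x (X i)) y * ?F y) \<longlonglongrightarrow> ?F y"
      proof (intro AE_I2)
        fix y
        show "(\<lambda>i. indicator (- ball x (X i)) y * ?F y) \<longlonglongrightarrow> ?F y"
        proof (cases "y = x")
          case False
          then have "\<forall>\<^sub>F i in sequentially. X i < norm (x - y)"
            using X(2) by (intro order_tendstoD(2)) auto
          then have "\<forall>\<^sub>F i in sequentially. indicator (- ball x (X i)) y * ?F y = ?F y"
            by eventually_elim (simp add: dist_norm)
          then show ?thesis by (rule tendsto_eventually)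
        qed simp
      qed
      show "integrable lebesgue (\<lambda>y. norm (?F y))" using F by (rule integrable_norm)
      show "(\<lambda>y. indicator (- ball x (X i)) y * ?F y) \<in> borel_measurable lebesgue" for i
        by measurable
      show "AE y in lebesgue. norm (indicator (- ball x (X i)) y * ?F y) \<le> norm (?F y)" for i
        by (intro AE_I2) (simp add: indicator_def)
    qed measurable
  qed
  then have "((\<lambda>\<epsilon>. LINT y:- ball x \<epsilon>|lebesgue. (v x - v y) / norm (x - y) powr q) \<longlongrightarrow> (LINT y|lebesgue. ?F y)) (at_right 0)"
    by (rule Lim_transform_eventually)
      (auto intro: eventually_mono[OF eventually_at_right_less[of 0]] simp: cut)
  then show "frac_laplacian s v x = frac_laplacian_const DIM('a) s * (LINT y|lebesgue. ?F y)"
    unfolding frac_laplacian_def q_def by (simp add: tendsto_Lim)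
qed

section \<open>Functions touched from above by a paraboloid\<close>

lemma
  fixes f f1 :: "real \<Rightarrow> real"
  assumes f: "\<forall>\<^sub>F h in nhds 0. (f has_real_derivative f1 h) (at h)"
    and f2: "(f1 has_real_derivative f2) (at 0)"
    and touch: "\<And>h. f h \<le> f 0 + a * h + k * h\<^sup>2"
  shows first_derivative_touching_parabola: "f1 0 = a"
    and second_derivative_touching_parabola: "f2 \<le> 2 * k"
proof -
  define g where "g = (\<lambda>h. f h - a * h - k * h\<^sup>2)"
  define g1 where "g1 = (\<lambda>h. f1 h - a - 2 * k * h)"
  have max: "g h \<le> g 0" for h using touch[of h] by (simp add: g_def)
  obtain d where d: "0 < d" "\<And>h. \<bar>h\<bar> < d \<Longrightarrow> (f has_real_derivative f1 h) (at h)"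
    using f unfolding eventually_nhds_metric by (auto simp: dist_real_def)
  have g: "(g has_real_derivative g1 h) (at h)" if "\<bar>h\<bar> < d" for h
    unfolding g_def g1_def by (rule derivative_eq_intros d(2)[OF that] refl | simp)+
  have g10: "g1 0 = 0"
    using DERIV_local_max[OF g[of 0], of 1] max d(1) by simp
  then show "f1 0 = a" by (simp add: g1_def)
  have g2: "(g1 has_real_derivative (f2 - 2 * k)) (at 0)"
    unfolding g1_def by (rule derivative_eq_intros f2 refl | simp)+
  show "f2 \<le> 2 * k"
  proof (rule ccontr)
    assume "\<not> f2 \<le> 2 * k"
    then have "0 < f2 - 2 * k" by simp
    then obtain e where e: "0 < e" "\<And>h. 0 < h \<Longrightarrow> h < e \<Longrightarrow> g1 0 < g1 h"
      using DERIV_pos_inc_right[OF g2] by auto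
    define b where "b = min d e / 2"
    have b: "0 < b" "b < d" "b < e" using d(1) e(1) by (auto simp: b_def)
    have "\<exists>z. 0 < z \<and> z < b \<and> g b - g 0 = (b - 0) * g1 z"
      using b by (intro MVT2 g) auto
    then obtain z where z: "0 < z" "z < b" "g b - g 0 = b * g1 z" by auto
    have "0 < g1 z" using e(2)[of z] z b g10 by simp
    then have "0 < b * g1 z" using b by simp
    then show False using z(3) max[of b] by linarith
  qed
qed

text \<open>
  The derivative of \<open>f\<close> is Lipschitz at \<open>x\<close>, because it is differentiable there; the mean value
  inequality on the ball through \<open>y\<close> turns this into a quadratic remainder.
\<close>

lemma second_order_taylor_bound:
  fixes f :: "'a::euclidean_space \<Rightarrow> real"
  assumes f': "\<And>y. y \<in> D \<Longrightarrow> (f has_derivative blinfun_apply (f' y)) (at y)"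
    and f'': "(f' has_derivative blinfun_apply f2) (at x)"
    and "open D" "x \<in> D"
  obtains K \<delta> where "0 < \<delta>"
    "\<And>y. norm (y - x) < \<delta> \<Longrightarrow> \<bar>f y - f x - f' x (y - x)\<bar> \<le> K * (norm (y - x))\<^sup>2"
proof -
  obtain r where r: "0 < r" "ball x r \<subseteq> D" using assms(3,4) openE by blast
  obtain d where d: "0 < d" "\<And>y. norm (y - x) < d \<Longrightarrow> norm (f' y - f' x - f2 (y - x)) \<le> 1 * norm (y - x)"
    using f'' unfolding has_derivative_at_alt by (metis zero_less_one)
  define K where "K = 1 + norm f2"
  have lip: "norm (f' y - f' x) \<le> K * norm (y - x)" if "norm (y - x) < d" for y
  proof -
    have "norm (f' y - f' x) \<le> norm (f' y - f' x - f2 (y - x)) + norm (f2 (y - x))"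
      using norm_triangle_ineq[of "f' y - f' x - f2 (y - x)" "f2 (y - x)"] by simp
    also have "\<dots> \<le> 1 * norm (y - x) + norm f2 * norm (y - x)"
      using d(2)[OF that] norm_blinfun by (intro add_mono)
    finally show ?thesis by (simp add: K_def algebra_simps)
  qed
  define \<delta> where "\<delta> = min r d"
  show ?thesis
  proof (rule that[of \<delta> K])
    show "0 < \<delta>" using r d by (simp add: \<delta>_def)
    fix y assume y: "norm (y - x) < \<delta>"
    have ball: "z \<in> D" "norm (z - x) < d" if "z \<in> cball x (norm (y - x))" for z
      using that y r(2) by (auto simp: \<delta>_def dist_norm norm_minus_commute)
    have "norm (f y - f x - f' x (y - x)) \<le> norm (y - x) * (K * norm (y - x))"
    proof (rule differentiable_bound_linearization[where S = "cball x (norm (y - x))"])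
      fix t :: real assume "t \<in> {0..1}"
      then show "x + t *\<^sub>R (y - x) \<in> cball x (norm (y - x))"
        by (simp add: dist_norm mult_left_le_one_le)
    next
      fix z assume z: "z \<in> cball x (norm (y - x))"
      show "(f has_derivative f' z) (at z within cball x (norm (y - x)))"
        using f'[OF ball(1)[OF z]] by (rule has_derivative_at_withinI)
      have "onorm (blinfun_apply (f' z) - blinfun_apply (f' x)) = norm (f' z - f' x)"
        by (simp add: norm_blinfun.rep_eq minus_blinfun.rep_eq fun_diff_def)
      also have "\<dots> \<le> K * norm (z - x)" using lip[OF ball(2)[OF z]] .
      also have "\<dots> \<le> K * norm (y - x)"
        using z by (intro mult_left_mono) (auto simp: K_def dist_norm norm_minus_commute)
      finally show "onorm (blinfun_apply (f' z) - blinfun_apply (f' x)) \<le> K * norm (y - x)" .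
    qed simp
    then show "\<bar>f y - f x - f' x (y - x)\<bar> \<le> K * (norm (y - x))\<^sup>2"
      by (simp add: power2_eq_square mult_ac)
  qed
qed

text \<open>
  Restricting to lines through \<open>x\<close> reduces both claims to parabolas touching a function of one
  variable. In particular the gradient of \<open>f\<close> at \<open>x\<close> must be the \<open>p\<close> of the paraboloid, so the Taylor
  bound can be stated with \<open>p\<close>.
\<close>

lemma
  fixes f :: "'a::euclidean_space \<Rightarrow> real"
  assumes C2: "C2_on D f" and "open D" "x \<in> D"
    and touch: "\<And>y. f y \<le> f x + p \<bullet> (y - x) + k * (norm (y - x))\<^sup>2"
  shows C2_on_taylor_touching:
      "\<exists>K \<delta>. 0 < \<delta> \<and> (\<forall>y. norm (y - x) < \<delta> \<longrightarrow> \<bar>f y - f x - p \<bullet> (y - x)\<bar> \<le> K * (norm (y - x))\<^sup>2)"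
    and laplacian_touching: "laplacian f x \<le> 2 * k * real DIM('a)"
proof -
  obtain f' :: "'a \<Rightarrow> 'a \<Rightarrow>\<^sub>L real" and f'' :: "'a \<Rightarrow> 'a \<Rightarrow>\<^sub>L ('a \<Rightarrow>\<^sub>L real)"
    where f': "\<And>y. y \<in> D \<Longrightarrow> (f has_derivative blinfun_apply (f' y)) (at y)"
      and f'': "\<And>y. y \<in> D \<Longrightarrow> (f' has_derivative blinfun_apply (f'' y)) (at y)"
    using C2 unfolding C2_on_def by auto
  have near: "\<forall>\<^sub>F h in nhds 0. x + h *\<^sub>R b \<in> D" for b
  proof -
    have "((\<lambda>h. x + h *\<^sub>R b) \<longlongrightarrow> x + 0 *\<^sub>R b) (nhds 0)"
      by (intro tendsto_intros filterlim_ident)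
    then show ?thesis using \<open>open D\<close> \<open>x \<in> D\<close> by (intro topological_tendstoD) auto
  qed
  have d1: "((\<lambda>h. f (x + h *\<^sub>R b)) has_real_derivative f' (x + h *\<^sub>R b) b) (at h)"
    if "x + h *\<^sub>R b \<in> D" for b h
  proof -
    have "((\<lambda>h. x + h *\<^sub>R b) has_derivative (\<lambda>t. t *\<^sub>R b)) (at h)"
      by (auto intro!: derivative_eq_intros)
    from has_derivative_compose[OF this f'[OF that]]
    show ?thesis by (simp add: has_field_derivative_def blinfun.scaleR_right mult_commute_abs)
  qed
  have d2: "((\<lambda>h. f' (x + h *\<^sub>R b) b) has_real_derivative f'' x b b) (at 0)" for b
  proof -
    have "((\<lambda>h. x + h *\<^sub>R b) has_derivative (\<lambda>t. t *\<^sub>R b)) (at 0)"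
      by (auto intro!: derivative_eq_intros)
    moreover have "(f' has_derivative blinfun_apply (f'' x)) (at (x + 0 *\<^sub>R b))" using f'' \<open>x \<in> D\<close> by simp
    ultimately have "((\<lambda>h. f' (x + h *\<^sub>R b)) has_derivative (\<lambda>t. f'' x (t *\<^sub>R b))) (at 0)"
      by (rule has_derivative_compose)
    then have "((\<lambda>h. f' (x + h *\<^sub>R b) b) has_derivative (\<lambda>t. f'' x (t *\<^sub>R b) b)) (at 0)"
      by (rule bounded_linear.has_derivative[OF blinfun.bounded_linear_left])
    then show ?thesis
      by (simp add: has_field_derivative_def blinfun.scaleR_right blinfun.scaleR_left mult_commute_abs)
  qed
  have line: "f (x + h *\<^sub>R b) \<le> f (x + 0 *\<^sub>R b) + (p \<bullet> b) * h + (k * (norm b)\<^sup>2) * h\<^sup>2" for b h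
    using touch[of "x + h *\<^sub>R b"] by (simp add: power_mult_distrib mult_ac)
  have grad: "f' x b = p \<bullet> b" for b
    using first_derivative_touching_parabola[OF eventually_mono[OF near d1] d2 line] by simp
  obtain K \<delta> where "0 < \<delta>"
    "\<And>y. norm (y - x) < \<delta> \<Longrightarrow> \<bar>f y - f x - f' x (y - x)\<bar> \<le> K * (norm (y - x))\<^sup>2"
    using second_order_taylor_bound[OF f' f''[OF \<open>x \<in> D\<close>] \<open>open D\<close> \<open>x \<in> D\<close>] by metis
  then show "\<exists>K \<delta>. 0 < \<delta> \<and> (\<forall>y. norm (y - x) < \<delta> \<longrightarrow> \<bar>f y - f x - p \<bullet> (y - x)\<bar> \<le> K * (norm (y - x))\<^sup>2)"
    unfolding grad by blast
  have "(deriv ^^ 2) (\<lambda>h. f (x + h *\<^sub>R b)) 0 \<le> 2 * k" if "b \<in> Basis" for b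
  proof -
    have "\<forall>\<^sub>F h in nhds 0. deriv (\<lambda>h. f (x + h *\<^sub>R b)) h = f' (x + h *\<^sub>R b) b"
      using near[of b] by eventually_elim (rule DERIV_imp_deriv[OF d1])
    then have "deriv (deriv (\<lambda>h. f (x + h *\<^sub>R b))) 0 = deriv (\<lambda>h. f' (x + h *\<^sub>R b) b) 0"
      by (rule deriv_cong_ev) simp
    also have "\<dots> = f'' x b b" by (rule DERIV_imp_deriv[OF d2])
    also have "\<dots> \<le> 2 * (k * (norm b)\<^sup>2)"
      by (rule second_derivative_touching_parabola[OF eventually_mono[OF near d1] d2 line])
    finally show ?thesis using that by (simp add: numeral_2_eq_2)
  qed
  then have "laplacian f x \<le> (\<Sum>b\<in>(Basis::'a set). 2 * k)"
    unfolding laplacian_def by (rule sum_mono)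
  then show "laplacian f x \<le> 2 * k * real DIM('a)" by (simp add: mult.commute)
qed

text \<open>
  For \<open>\<alpha> = 1\<close> the derivative of \<open>v\<close> equals that of the touching parabola. For \<open>\<alpha> < 1\<close> the two upper
  bounds give \<open>v t - v \<tau> \<ge> - 3 m min 1 (\<bar>t - \<tau>\<bar> / T)\<close>, so the integrand is bounded below by the truncated
  kernel with \<open>\<kappa> = 1\<close> and \<open>\<beta> = \<alpha>\<close>. A lower bound by a nonpositive number is all that is claimed, so it
  also holds when the integral diverges and has the default value \<open>0\<close>.
\<close>

lemma time_deriv_touching:
  assumes \<alpha>: "0 < \<alpha>" "\<alpha> \<le> 1"
  obtains C where "0 < C"
    "\<And>v m T t t0. v C1_differentiable_on UNIV \<Longrightarrow> 0 < T \<Longrightarrow> 0 \<le> m \<Longrightarrow> \<bar>t - t0\<bar> < T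
      \<Longrightarrow> (\<And>\<tau>. v \<tau> \<le> v t + m)
      \<Longrightarrow> (\<And>\<tau>. v \<tau> \<le> v t + m * ((\<tau> - t0)\<^sup>2 - (t - t0)\<^sup>2) / T\<^sup>2)
      \<Longrightarrow> - (C * m * T powr (- \<alpha>)) \<le> time_deriv \<alpha> v t"
proof (cases "\<alpha> = 1")
  case True
  show ?thesis
  proof (rule that[of 2])
    fix v :: "real \<Rightarrow> real" and m T t t0 :: real
    assume v: "v C1_differentiable_on UNIV" and T: "0 < T" and m: "0 \<le> m" and t: "\<bar>t - t0\<bar> < T"
      and touch: "\<And>\<tau>. v \<tau> \<le> v t + m * ((\<tau> - t0)\<^sup>2 - (t - t0)\<^sup>2) / T\<^sup>2"
    obtain v' where v': "\<And>\<tau>. (v has_real_derivative v' \<tau>) (at \<tau>)"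
      using v unfolding C1_differentiable_on_def has_real_derivative_iff_has_vector_derivative by auto
    let ?g = "\<lambda>\<tau>. v \<tau> - m * (\<tau> - t0)\<^sup>2 / T\<^sup>2"
    have "(?g has_real_derivative v' t - 2 * m * (t - t0) / T\<^sup>2) (at t)"
      using T by (auto intro!: derivative_eq_intros v' simp: power2_eq_square)
    moreover have "?g \<tau> \<le> ?g t" for \<tau>
      using touch[of \<tau>] by (simp add: right_diff_distrib diff_divide_distrib)
    ultimately have "v' t - 2 * m * (t - t0) / T\<^sup>2 = 0"
      by (intro DERIV_local_max[of ?g _ t 1]) auto
    then have eq: "v' t = 2 * m * (t - t0) / T\<^sup>2" by simp
    have "2 * m * (- T) / T\<^sup>2 \<le> 2 * m * (t - t0) / T\<^sup>2"
      using t m by (intro divide_right_mono mult_left_mono) auto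
    then have "- (2 * m * T powr (- 1)) \<le> v' t"
      unfolding eq using T by (simp add: power2_eq_square powr_minus_divide)
    moreover have "deriv v t = v' t" using v' by (rule DERIV_imp_deriv)
    ultimately show "- (2 * m * T powr (- \<alpha>)) \<le> time_deriv \<alpha> v t"
      using True by (simp add: time_deriv_def)
  qed simp
next
  case False
  then have \<alpha>1: "\<alpha> < 1" using \<alpha> by simp
  obtain C where C: "0 < C"
    "\<And>x R :: real. 0 < R \<Longrightarrow> integrable lebesgue (\<lambda>y. min 1 ((\<bar>x - y\<bar> / R) powr 1) / \<bar>x - y\<bar> powr (1 + \<alpha>))"
    "\<And>x R :: real. 0 < R \<Longrightarrow>
       (LINT y|lebesgue. min 1 ((\<bar>x - y\<bar> / R) powr 1) / \<bar>x - y\<bar> powr (1 + \<alpha>)) \<le> C * R powr (- \<alpha>)"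
    using truncated_riesz_kernel_bound[of \<alpha> 1, where ?'a = real] \<alpha>(1) \<alpha>1 by auto
  define A where "A = \<alpha> / Gamma (1 - \<alpha>)"
  have A: "0 < A" using \<alpha> \<alpha>1 by (simp add: A_def Gamma_real_pos)
  show ?thesis
  proof (rule that[of "3 * A * C"])
    fix v :: "real \<Rightarrow> real" and m T t t0 :: real
    assume T: "0 < T" and m: "0 \<le> m" and t: "\<bar>t - t0\<bar> < T"
      and touch1: "\<And>\<tau>. v \<tau> \<le> v t + m"
      and touch2: "\<And>\<tau>. v \<tau> \<le> v t + m * ((\<tau> - t0)\<^sup>2 - (t - t0)\<^sup>2) / T\<^sup>2"
    let ?k = "\<lambda>\<tau>. min 1 ((\<bar>t - \<tau>\<bar> / T) powr 1) / \<bar>t - \<tau>\<bar> powr (1 + \<alpha>)"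
    let ?g = "\<lambda>\<tau>. indicator {..<t} \<tau> *\<^sub>R ((v t - v \<tau>) / (t - \<tau>) powr (1 + \<alpha>))"
    have pw: "- (3 * m) * ?k \<tau> \<le> ?g \<tau>" for \<tau>
    proof (cases "\<tau> < t")
      case False
      have "0 \<le> 3 * m * ?k \<tau>" using m by (intro mult_nonneg_nonneg divide_nonneg_nonneg) auto
      then show ?thesis using False by simp
    next
      case True
      define r where "r = (t - \<tau>) / T"
      have r: "0 < r" using True T by (simp add: r_def)
      have \<tau>: "\<tau> = t - T * r" using T by (simp add: r_def)
      have "v \<tau> \<le> v t + 3 * m * min 1 r"
      proof (cases "r \<le> 1")
        case True
        have "((\<tau> - t0)\<^sup>2 - (t - t0)\<^sup>2) / T\<^sup>2 = r\<^sup>2 - 2 * r * ((t - t0) / T)"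
          using T by (simp add: \<tau> field_simps power2_eq_square)
        also have "\<dots> \<le> r * 1 + 2 * r * 1"
        proof -
          have "- 1 \<le> (t - t0) / T" using t T by (simp add: field_simps)
          then have "2 * r * (- 1) \<le> 2 * r * ((t - t0) / T)" using r by (intro mult_left_mono) auto
          moreover have "r\<^sup>2 \<le> r * 1" unfolding power2_eq_square using r True by (intro mult_left_mono) auto
          ultimately show ?thesis by linarith
        qed
        finally have "m * (((\<tau> - t0)\<^sup>2 - (t - t0)\<^sup>2) / T\<^sup>2) \<le> m * (3 * r)"
          using m by (intro mult_left_mono) auto
        then show ?thesis using touch2[of \<tau>] True by simp
      next
        case False
        then show ?thesis using touch1[of \<tau>] m by simp
      qed
      then have "- (3 * m) * min 1 r / (t - \<tau>) powr (1 + \<alpha>) \<le> (v t - v \<tau>) / (t - \<tau>) powr (1 + \<alpha>)"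
        by (intro divide_right_mono) auto
      then show ?thesis using True r T by (simp add: r_def)
    qed
    have bound: "- (3 * m) * (C * T powr (- \<alpha>)) \<le> (LINT \<tau>|lebesgue. ?g \<tau>)"
    proof (cases "integrable lebesgue ?g")
      case True
      have "- (3 * m) * (C * T powr (- \<alpha>)) \<le> - (3 * m) * (LINT \<tau>|lebesgue. ?k \<tau>)"
        using C(3)[OF T, of t] m by (intro mult_left_mono_neg) auto
      also have "\<dots> = (LINT \<tau>|lebesgue. - (3 * m) * ?k \<tau>)" by (rule integral_mult_right_zero[symmetric])
      also have "\<dots> \<le> (LINT \<tau>|lebesgue. ?g \<tau>)"
        using C(2)[OF T, of t] True by (intro integral_mono pw integrable_mult_right)
      finally show ?thesis .
    next
      case False
      then have "(LINT \<tau>|lebesgue. ?g \<tau>) = 0" by (rule not_integrable_integral_eq)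
      moreover have "0 \<le> 3 * m * (C * T powr (- \<alpha>))" using m C(1) by simp
      ultimately show ?thesis by simp
    qed
    have "A * (- (3 * m) * (C * T powr (- \<alpha>))) \<le> A * (LINT \<tau>|lebesgue. ?g \<tau>)"
      using A bound by (intro mult_left_mono) auto
    also have "\<dots> = time_deriv \<alpha> v t"
      using \<alpha>1 by (simp add: time_deriv_def A_def set_lebesgue_integral_def)
    finally show "- (3 * A * C * m * T powr (- \<alpha>)) \<le> time_deriv \<alpha> v t" by (simp add: mult_ac)
  qed (use A C in simp)
qed

lemma frac_laplacian_const_pos:
  assumes "0 < n" "0 < s" "s < 1"
  shows "0 < frac_laplacian_const n s"
proof -
  have "Gamma (- s) \<noteq> 0"
    using assms by (auto simp: Gamma_eq_zero_iff elim!: nonpos_Ints_cases')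
  then show ?thesis
    using assms unfolding frac_laplacian_const_def
    by (intro divide_pos_pos mult_pos_pos Gamma_real_pos) auto
qed

lemma recentered_paraboloid:
  fixes x y x0 :: "'a::real_inner"
  shows "m * ((norm (y - x0))\<^sup>2 - (norm (x - x0))\<^sup>2) / R\<^sup>2
     = (2 * m / R\<^sup>2) *\<^sub>R (x - x0) \<bullet> (y - x) + m / R\<^sup>2 * (norm (y - x))\<^sup>2"
proof -
  have "(norm (y - x0))\<^sup>2 - (norm (x - x0))\<^sup>2 = 2 * ((x - x0) \<bullet> (y - x)) + (norm (y - x))\<^sup>2"
    by (simp add: power2_norm_eq_inner algebra_simps inner_commute)
  then show ?thesis by (simp add: add_divide_distrib distrib_left)
qed

text \<open>
  With the correction taken on the ball of radius \<open>R\<close>, the corrected integrand is at least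
  \<open>- m min 1 (\<bar>x - y\<bar> / R)\<^sup>2 / \<bar>x - y\<bar>\<^bsup>n + 2 s\<^esup>\<close> everywhere, which costs \<open>C m R\<^sup>-\<^sup>2\<^sup>s\<close>. Outside \<open>D\<close> its numerator
  is at least \<open>v x - 2 m\<close>, the loss \<open>2 m\<close> being the largest possible size of the correction; the
  points of \<open>B\<^sub>R (x\<^sub>0) - D\<close> are within distance \<open>2 R\<close> of \<open>x\<close>, which gives the positive term.
\<close>

lemma frac_laplacian_touching:
  assumes s: "0 < s" "s < 1"
  obtains C where "0 < C"
    "\<And>(v :: 'a::euclidean_space \<Rightarrow> real) D m R x x0.
       v \<in> Ltilde s \<Longrightarrow> C2_on D v \<Longrightarrow> open D \<Longrightarrow> x \<in> D \<Longrightarrow>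
       0 < R \<Longrightarrow> 0 \<le> m \<Longrightarrow> norm (x - x0) < R \<Longrightarrow>
       (\<And>y. v y \<le> v x + m) \<Longrightarrow>
       (\<And>y. v y \<le> v x + m * ((norm (y - x0))\<^sup>2 - (norm (x - x0))\<^sup>2) / R\<^sup>2) \<Longrightarrow>
       (\<And>y. y \<notin> D \<Longrightarrow> v y \<le> 0) \<Longrightarrow> 2 * m \<le> v x \<Longrightarrow>
       frac_laplacian_const DIM('a) s *
         ((v x - 2 * m) * measure lebesgue (ball x0 R \<inter> - D) / (2 * R) powr (real DIM('a) + 2 * s)
           - C * m * R powr (- (2 * s))) \<le> frac_laplacian s v x"
proof -
  define q where "q = real DIM('a) + 2 * s"
  have q: "0 < q" using s by (simp add: q_def)
  obtain C where C: "0 < C"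
    "\<And>(x::'a) R. 0 < R \<Longrightarrow> integrable lebesgue (\<lambda>y. min 1 ((norm (x - y) / R) powr 2) / norm (x - y) powr q)"
    "\<And>(x::'a) R. 0 < R \<Longrightarrow>
       (LINT y|lebesgue. min 1 ((norm (x - y) / R) powr 2) / norm (x - y) powr q) \<le> C * R powr (- (2 * s))"
    using truncated_riesz_kernel_bound[of "2 * s" 2, where ?'a = 'a] s unfolding q_def by auto
  show ?thesis
  proof (rule that[OF C(1)])
    fix v :: "'a \<Rightarrow> real" and D m R x x0
    assume v: "v \<in> Ltilde s" and C2: "C2_on D v" and D: "open D" "x \<in> D"
      and R: "0 < R" and m: "0 \<le> m" and x: "norm (x - x0) < R"
      and touch1: "\<And>y. v y \<le> v x + m"
      and touch: "\<And>y. v y \<le> v x + m * ((norm (y - x0))\<^sup>2 - (norm (x - x0))\<^sup>2) / R\<^sup>2"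
      and ext: "\<And>y. y \<notin> D \<Longrightarrow> v y \<le> 0" and pos: "2 * m \<le> v x"
    define p where "p = (2 * m / R\<^sup>2) *\<^sub>R (x - x0)"
    have touch2: "v y \<le> v x + p \<bullet> (y - x) + m / R\<^sup>2 * (norm (y - x))\<^sup>2" for y
      using touch[of y] unfolding recentered_paraboloid p_def by simp
    obtain K \<delta> where \<delta>: "0 < \<delta>"
      and taylor: "\<And>y. norm (y - x) < \<delta> \<Longrightarrow> \<bar>v y - v x - p \<bullet> (y - x)\<bar> \<le> K * (norm (y - x))\<^sup>2"
      using C2_on_taylor_touching[OF C2 D touch2] by blast
    let ?N = "\<lambda>y. v x - v y + indicator (ball x R) y * (p \<bullet> (y - x))"
    let ?F = "\<lambda>y. ?N y / norm (x - y) powr q"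
    let ?k = "\<lambda>y. min 1 ((norm (x - y) / R) powr 2) / norm (x - y) powr q"
    let ?S = "ball x0 R \<inter> - D"
    let ?c = "(v x - 2 * m) / (2 * R) powr q"
    have lower: "- m * min 1 ((norm (x - y) / R) powr 2) \<le> ?N y" for y
    proof (cases "norm (x - y) < R")
      case True
      then have "min 1 ((norm (x - y) / R) powr 2) = (norm (x - y) / R) powr 2"
        using R by (intro min_absorb2) (simp add: power_le_one)
      also have "\<dots> = (norm (y - x))\<^sup>2 / R\<^sup>2"
        using R by (simp add: power_divide norm_minus_commute)
      finally show ?thesis using touch2[of y] True by (simp add: dist_norm)
    next
      case False
      then have "1 \<le> (norm (x - y) / R)\<^sup>2" using R by (intro one_le_power) simp
      then show ?thesis using touch1[of y] False R by (simp add: dist_norm)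
    qed
    have far: "v x - 2 * m \<le> ?N y" if "y \<notin> D" for y
    proof (cases "norm (x - y) < R")
      case True
      have "\<bar>p \<bullet> (y - x)\<bar> \<le> norm p * norm (y - x)" by (rule Cauchy_Schwarz_ineq2)
      also have "norm p = 2 * m / R\<^sup>2 * norm (x - x0)" unfolding p_def using m by simp
      also have "\<dots> * norm (y - x) \<le> 2 * m / R\<^sup>2 * R * R"
        using x True m R by (intro mult_mono) (auto simp: norm_minus_commute)
      also have "\<dots> = 2 * m" using R by (simp add: power2_eq_square)
      finally show ?thesis using ext[OF that] True by (simp add: dist_norm)
    next
      case False
      then show ?thesis using ext[OF that] m by (simp add: dist_norm)
    qed
    \<comment> \<open>The kernel term is nonpositive, so the two lower bounds may be added.\<close>
    have pw: "- m * ?k y + ?c * indicator ?S y \<le> ?F y" for y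
    proof (cases "y \<in> ?S")
      case False
      have "- m * min 1 ((norm (x - y) / R) powr 2) / norm (x - y) powr q \<le> ?F y"
        by (intro divide_right_mono lower) auto
      then show ?thesis using False by simp
    next
      case True
      have "norm (x - y) \<le> norm (x - x0) + norm (x0 - y)"
        using norm_triangle_ineq[of "x - x0" "x0 - y"] by simp
      also have "\<dots> \<le> 2 * R" using True x by (simp add: dist_norm)
      finally have near: "norm (x - y) \<le> 2 * R" .
      have "x \<noteq> y" using True D(2) by auto
      then have "?c \<le> (v x - 2 * m) / norm (x - y) powr q"
        using near pos q R by (intro divide_left_mono powr_mono2 mult_pos_pos) auto
      also have "\<dots> \<le> ?F y"
        using far[of y] True by (intro divide_right_mono) auto
      finally have "?c \<le> ?F y" .
      moreover have "0 \<le> m * ?k y" using m by (intro mult_nonneg_nonneg divide_nonneg_nonneg) auto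
      ultimately show ?thesis using True by simp
    qed
    have S: "?S \<in> sets lebesgue" "emeasure lebesgue ?S < \<infinity>"
    proof -
      show S: "?S \<in> sets lebesgue" using D(1) by auto
      have "emeasure lebesgue ?S \<le> emeasure lebesgue (ball x0 R)" using S by (intro emeasure_mono) auto
      also have "\<dots> < \<infinity>" using emeasure_bounded_finite[of "ball x0 R"] by simp
      finally show "emeasure lebesgue ?S < \<infinity>" .
    qed
    have ind: "integrable lebesgue (\<lambda>y. ?c * indicator ?S y :: real)" using S by simp
    have ker: "integrable lebesgue (\<lambda>y. - m * ?k y)" using C(2)[OF R] by (rule integrable_mult_right)
    have "?c * measure lebesgue ?S - C * m * R powr (- (2 * s))
        \<le> - m * (LINT y|lebesgue. ?k y) + ?c * (LINT y|lebesgue. indicator ?S y)"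
    proof -
      have "m * (LINT y|lebesgue. ?k y) \<le> m * (C * R powr (- (2 * s)))"
        using C(3)[OF R] m by (intro mult_left_mono) auto
      then show ?thesis using S by (simp add: mult_ac)
    qed
    also have "\<dots> = (LINT y|lebesgue. - m * ?k y + ?c * indicator ?S y)"
      unfolding Bochner_Integration.integral_add[OF ker ind] by (simp only: integral_mult_right_zero)
    also have "\<dots> \<le> (LINT y|lebesgue. ?F y)"
      using corrected_integrand_integrable[OF s v \<delta> R taylor] unfolding q_def[symmetric]
      by (intro integral_mono pw Bochner_Integration.integrable_add ker ind)
    finally have lint: "?c * measure lebesgue ?S - C * m * R powr (- (2 * s)) \<le> (LINT y|lebesgue. ?F y)" .
    have eq: "frac_laplacian s v x = frac_laplacian_const DIM('a) s * (LINT y|lebesgue. ?F y)"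
      unfolding q_def by (rule frac_laplacian_corrected[OF s v \<delta> R taylor])
    have "frac_laplacian_const DIM('a) s * (?c * measure lebesgue ?S - C * m * R powr (- (2 * s)))
        \<le> frac_laplacian s v x"
      unfolding eq using lint frac_laplacian_const_pos[of "DIM('a)" s] s by (intro mult_left_mono) auto
    then show "frac_laplacian_const DIM('a) s *
         ((v x - 2 * m) * measure lebesgue (ball x0 R \<inter> - D) / (2 * R) powr (real DIM('a) + 2 * s)
           - C * m * R powr (- (2 * s))) \<le> frac_laplacian s v x"
      by (simp add: q_def)
  qed
qed

section \<open>Maximum points of the penalized function\<close>

text \<open>
  If no maximum existed, every \<open>p\<close> would have a better point \<open>g p\<close>, which by semicontinuity also beats
  all points of a neighbourhood of \<open>p\<close>. Among the finitely many \<open>g p\<close> belonging to a finite subcover,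
  the best one would then be beaten by another of them.
\<close>

lemma upper_semicontinuous_attains_max:
  fixes f :: "'a::topological_space \<Rightarrow> real"
  assumes "compact S" "S \<noteq> {}" and usc: "upper_semicontinuous_on S f"
  obtains p where "p \<in> S" "\<And>q. q \<in> S \<Longrightarrow> f q \<le> f p"
proof (rule ccontr)
  assume "\<not> thesis"
  then have "\<forall>p\<in>S. \<exists>q\<in>S. f p < f q" using that by (meson not_le)
  then obtain g where g: "\<And>p. p \<in> S \<Longrightarrow> g p \<in> S \<and> f p < f (g p)" by metis
  have "\<exists>U. open U \<and> p \<in> U \<and> (\<forall>q\<in>U \<inter> S. f q < f (g p))" if "p \<in> S" for p
  proof -
    have "\<forall>\<^sub>F q in at p within S. f q < f (g p)"
      using usc g[OF that] that by (auto simp: upper_semicontinuous_on_def)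
    then show ?thesis using g[OF that] unfolding eventually_at_topological by (metis IntE)
  qed
  then obtain U where U: "\<And>p. p \<in> S \<Longrightarrow> open (U p) \<and> p \<in> U p \<and> (\<forall>q\<in>U p \<inter> S. f q < f (g p))" by metis
  have "\<And>p. p \<in> S \<Longrightarrow> open (U p)" "S \<subseteq> (\<Union>p\<in>S. U p)" using U by blast+
  then obtain T where T: "T \<subseteq> S" "finite T" "S \<subseteq> (\<Union>p\<in>T. U p)"
    using compactE_image[OF \<open>compact S\<close>, of S U] by auto
  then have "T \<noteq> {}" using \<open>S \<noteq> {}\<close> by auto
  let ?m = "Max ((\<lambda>r. f (g r)) ` T)"
  have "?m \<in> (\<lambda>r. f (g r)) ` T" using T(2) \<open>T \<noteq> {}\<close> by (intro Max_in) auto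
  moreover have "f (g r) \<le> ?m" if "r \<in> T" for r using T(2) that by (intro Max_ge) auto
  ultimately obtain p where p: "p \<in> T" "\<And>r. r \<in> T \<Longrightarrow> f (g r) \<le> f (g p)" by force
  have "g p \<in> S" using p T g by auto
  then obtain r where "r \<in> T" "g p \<in> U r" using T by auto
  then have "f (g p) < f (g r)" using U[of r] T(1) \<open>g p \<in> S\<close> by auto
  then show False using p(2)[OF \<open>r \<in> T\<close>] by simp
qed

lemma upper_semicontinuous_on_diff_continuous:
  assumes "upper_semicontinuous_on S f" "continuous_on S g"
  shows "upper_semicontinuous_on S (\<lambda>p. f p - g p)"
  unfolding upper_semicontinuous_on_def
proof (intro ballI allI impI)
  fix p c assume p: "p \<in> S" and c: "f p - g p < c"
  define e where "e = (c - (f p - g p)) / 2"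
  have e: "0 < e" using c by (simp add: e_def)
  have "\<forall>\<^sub>F q in at p within S. f q < f p + e"
    using assms(1) p e unfolding upper_semicontinuous_on_def by (metis less_add_same_cancel1)
  moreover have "\<forall>\<^sub>F q in at p within S. g p - e < g q"
    using assms(2) p e by (intro order_tendstoD(1)) (auto simp: continuous_on_def)
  ultimately show "\<forall>\<^sub>F q in at p within S. f q - g q < c"
    by eventually_elim (simp add: e_def field_simps)
qed

lemma upper_semicontinuous_on_subset:
  assumes "upper_semicontinuous_on S f" "T \<subseteq> S"
  shows "upper_semicontinuous_on T f"
  using assms filter_leD[OF at_le[OF assms(2)]] unfolding upper_semicontinuous_on_def by blast

text \<open>
  The penalty is at least \<open>m\<close> outside the cylinder, so there the penalized function stays below
  \<open>M - m\<close>, which is below its value at \<open>(x\<^sub>0, t\<^sub>0)\<close>; and outside \<open>D\<close> it is at most \<open>0\<close>. A maximum over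
  the compact cylinder, cut down to the closure of \<open>D\<close>, is therefore a maximum over the whole of
  space-time, and it is attained in the open cylinder, although the penalty is not localized.
\<close>

lemma penalized_maximum:
  fixes u :: "'a::euclidean_space \<Rightarrow> real \<Rightarrow> real"
  assumes usc: "upper_semicontinuous_on (closure D \<times> UNIV) (\<lambda>(x, t). u x t)"
    and ub: "\<And>x t. u x t \<le> M"
    and ext: "\<And>x t. x \<notin> D \<Longrightarrow> u x t \<le> 0"
    and m: "0 < m" "m < M" and start: "M - m < u x0 t0" and R: "0 < R" and T: "0 < T"
  obtains x t where "x \<in> D" "norm (x - x0) < R" "\<bar>t - t0\<bar> < T" "M - m < u x t"
    "\<And>y \<tau>. u y \<tau> - m * ((norm (y - x0))\<^sup>2 / R\<^sup>2 + (\<tau> - t0)\<^sup>2 / T\<^sup>2)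
        \<le> u x t - m * ((norm (x - x0))\<^sup>2 / R\<^sup>2 + (t - t0)\<^sup>2 / T\<^sup>2)"
proof -
  define b where "b = (\<lambda>y \<tau>. m * ((norm (y - x0))\<^sup>2 / R\<^sup>2 + (\<tau> - t0)\<^sup>2 / T\<^sup>2))"
  let ?w = "\<lambda>y \<tau>. u y \<tau> - b y \<tau>"
  let ?S = "(closure D \<inter> cball x0 R) \<times> {t0 - T..t0 + T}"
  have b0: "0 \<le> b y \<tau>" for y \<tau> using m by (simp add: b_def)
  have "x0 \<in> D" using start m ext[of x0 t0] by force
  then have S0: "(x0, t0) \<in> ?S" using R T closure_subset by auto
  have w0: "?w x0 t0 = u x0 t0" by (simp add: b_def)
  have "upper_semicontinuous_on ?S (\<lambda>z. (case z of (y, \<tau>) \<Rightarrow> u y \<tau>) - (case z of (y, \<tau>) \<Rightarrow> b y \<tau>))"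
    unfolding b_def case_prod_unfold
    by (intro upper_semicontinuous_on_diff_continuous continuous_intros
          upper_semicontinuous_on_subset[OF usc[unfolded case_prod_unfold]]) (use R T in auto)
  moreover have "compact ?S" by (intro compact_Times closed_Int_compact) auto
  ultimately obtain z where z: "z \<in> ?S"
    "\<And>z'. z' \<in> ?S \<Longrightarrow> (case z' of (y, \<tau>) \<Rightarrow> u y \<tau>) - (case z' of (y, \<tau>) \<Rightarrow> b y \<tau>)
        \<le> (case z of (y, \<tau>) \<Rightarrow> u y \<tau>) - (case z of (y, \<tau>) \<Rightarrow> b y \<tau>)"
    using upper_semicontinuous_attains_max S0 by (metis (no_types, lifting) empty_iff)
  obtain x t where xt: "z = (x, t)" by (cases z)
  have max: "?w y \<tau> \<le> ?w x t" if "(y, \<tau>) \<in> ?S" for y \<tau> using z(2)[OF that] by (simp add: xt)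
  have high: "M - m < ?w x t" using max[OF S0] w0 start by linarith
  have u_high: "M - m < u x t" using high b0[of x t] by linarith
  have edge: "?w y \<tau> \<le> M - m" if "R \<le> norm (y - x0) \<or> T \<le> \<bar>\<tau> - t0\<bar>" for y \<tau>
  proof -
    have "1 \<le> (norm (y - x0))\<^sup>2 / R\<^sup>2 \<or> 1 \<le> (\<tau> - t0)\<^sup>2 / T\<^sup>2"
      using that R T by (auto simp: abs_le_square_iff[symmetric])
    moreover have "0 \<le> (norm (y - x0))\<^sup>2 / R\<^sup>2" "0 \<le> (\<tau> - t0)\<^sup>2 / T\<^sup>2" by auto
    ultimately have "1 \<le> (norm (y - x0))\<^sup>2 / R\<^sup>2 + (\<tau> - t0)\<^sup>2 / T\<^sup>2" by linarith
    then have "m * 1 \<le> b y \<tau>" unfolding b_def using m by (intro mult_left_mono) auto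
    then show ?thesis using ub[of y \<tau>] by linarith
  qed
  have glob: "?w y \<tau> \<le> ?w x t" for y \<tau>
  proof (cases "(y, \<tau>) \<in> ?S")
    case False
    then have "y \<notin> D \<or> R \<le> norm (y - x0) \<or> T \<le> \<bar>\<tau> - t0\<bar>"
      using closure_subset[of D] by (auto simp: dist_norm norm_minus_commute)
    then show ?thesis
    proof
      assume "y \<notin> D"
      then show ?thesis using ext[of y \<tau>] b0[of y \<tau>] high m by linarith
    next
      assume "R \<le> norm (y - x0) \<or> T \<le> \<bar>\<tau> - t0\<bar>"
      then show ?thesis using edge[of y \<tau>] high by linarith
    qed
  qed (rule max)
  show ?thesis
  proof (rule that)
    show "x \<in> D" using ext[of x t] u_high m by force
    show "norm (x - x0) < R" using edge[of x t] high by force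
    show "\<bar>t - t0\<bar> < T" using edge[of x t] high by force
  qed (use u_high glob in \<open>auto simp: b_def\<close>)
qed

section \<open>The maximum principle\<close>

theorem theorem1p8:
  fixes s \<alpha> c\<^sub>0 :: real
    and D :: "(real ^ 'n) set"
    and u :: "real ^ 'n \<Rightarrow> real \<Rightarrow> real"
  assumes "0 < s" and "s < 1" and "0 < \<alpha>" and "\<alpha> \<le> 1"
    and "open D"
    and "c\<^sub>0 > 0"
    and "\<And>x\<^sub>0. Liminf at_top (\<lambda>R. ereal (measure lebesgue (ball x\<^sub>0 R \<inter> - D)
                                          / measure lebesgue (ball x\<^sub>0 R))) \<ge> ereal c\<^sub>0"
    and "\<And>t. C2_on D (\<lambda>x. u x t)"
    and "\<And>t. (\<lambda>x. u x t) \<in> Ltilde s"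
    and "\<And>x. u x C1_differentiable_on UNIV"
    and "\<And>x. u x \<in> Lminus \<alpha>"
    and "upper_semicontinuous_on (closure D \<times> UNIV) (\<lambda>(x, t). u x t)"
    and "bdd_above (range (\<lambda>(x, t). u x t))"
    and "\<And>x t. x \<in> D \<Longrightarrow> u x t > 0 \<Longrightarrow>
           time_deriv \<alpha> (u x) t + frac_laplacian s (\<lambda>y. u y t) x - laplacian (\<lambda>y. u y t) x \<le> 0"
    and "\<And>x t. x \<notin> D \<Longrightarrow> u x t \<le> 0"
  shows "\<forall>x\<in>D. \<forall>t. u x t \<le> 0"
proof (rule ccontr)
  note ext = assms(15) and pde = assms(14)
  assume "\<not> (\<forall>x\<in>D. \<forall>t. u x t \<le> 0)"
  then obtain x1 t1 where pos: "0 < u x1 t1" by (auto simp: not_le)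
  define M where "M = Sup (range (\<lambda>(x, t). u x t))"
  have ub: "u x t \<le> M" for x t
    unfolding M_def using assms(13) by (intro cSup_upper) auto
  have M: "0 < M" using pos ub[of x1 t1] by linarith
  define n where "n = real DIM(real ^ 'n)"
  define q where "q = n + 2 * s"
  define w where "w = unit_ball_vol n"
  define A where "A = frac_laplacian_const DIM(real ^ 'n) s"
  have n: "0 < n" by (simp add: n_def)
  have w: "0 < w" using n by (simp add: w_def)
  have A: "0 < A" unfolding A_def using assms(1,2) by (intro frac_laplacian_const_pos) auto
  obtain C where C: "0 < C" and frac:
    "\<And>(v :: real ^ 'n \<Rightarrow> real) D m R x x0.
       v \<in> Ltilde s \<Longrightarrow> C2_on D v \<Longrightarrow> open D \<Longrightarrow> x \<in> D \<Longrightarrow>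
       0 < R \<Longrightarrow> 0 \<le> m \<Longrightarrow> norm (x - x0) < R \<Longrightarrow>
       (\<And>y. v y \<le> v x + m) \<Longrightarrow>
       (\<And>y. v y \<le> v x + m * ((norm (y - x0))\<^sup>2 - (norm (x - x0))\<^sup>2) / R\<^sup>2) \<Longrightarrow>
       (\<And>y. y \<notin> D \<Longrightarrow> v y \<le> 0) \<Longrightarrow> 2 * m \<le> v x \<Longrightarrow>
       A * ((v x - 2 * m) * measure lebesgue (ball x0 R \<inter> - D) / (2 * R) powr q
           - C * m * R powr (- (2 * s))) \<le> frac_laplacian s v x"
    unfolding A_def q_def n_def using frac_laplacian_touching[OF assms(1,2), where ?'a = "real ^ 'n"] by blast
  obtain Ct where Ct: "0 < Ct" and time:
    "\<And>v m T t t0. v C1_differentiable_on UNIV \<Longrightarrow> 0 < T \<Longrightarrow> 0 \<le> m \<Longrightarrow> \<bar>t - t0\<bar> < T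
      \<Longrightarrow> (\<And>\<tau>. v \<tau> \<le> v t + m)
      \<Longrightarrow> (\<And>\<tau>. v \<tau> \<le> v t + m * ((\<tau> - t0)\<^sup>2 - (t - t0)\<^sup>2) / T\<^sup>2)
      \<Longrightarrow> - (Ct * m * T powr (- \<alpha>)) \<le> time_deriv \<alpha> v t"
    using time_deriv_touching[OF assms(3,4)] by blast
  \<comment> \<open>Up to the normalization \<open>A\<close>, \<open>c1 M R\<^sup>-\<^sup>2\<^sup>s\<close> is the gain from the complement of \<open>D\<close>: one factor \<open>1 / 2\<close> pays for
    \<open>u x t - 2 m \<ge> M / 2\<close>, the other for replacing the lower limit \<open>c\<^sub>0\<close> of the density by \<open>c\<^sub>0 / 2\<close>.
    The constant \<open>L\<close> collects the errors of the three terms.\<close>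
  define c1 where "c1 = c\<^sub>0 * w / (4 * 2 powr q)"
  have c1: "0 < c1" using assms(6) w by (simp add: c1_def)
  define L where "L = A * C + 2 * n + 1"
  have L: "0 < L" unfolding L_def using A C n by (intro add_pos_pos mult_pos_pos) auto
  define \<epsilon> where "\<epsilon> = min (1 / 6) (A * c1 / (2 * L))"
  have \<epsilon>: "0 < \<epsilon>" "\<epsilon> \<le> 1 / 6" using A c1 L by (auto simp: \<epsilon>_def)
  have "\<epsilon> * L \<le> A * c1 / (2 * L) * L" using L by (intro mult_right_mono) (auto simp: \<epsilon>_def)
  also have "\<dots> < A * c1" using A c1 L by simp
  finally have gap: "\<epsilon> * L < A * c1" .
  define m where "m = \<epsilon> * M"
  have m: "0 < m" "6 * m \<le> M" using \<epsilon> M by (auto simp: m_def)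
  have "M - m < Sup (range (\<lambda>(x, t). u x t))" using m by (simp add: M_def)
  then obtain x0 t0 where start: "M - m < u x0 t0"
    by (subst (asm) less_cSup_iff) (use assms(13) in auto)
  have "\<forall>\<^sub>F R in at_top. ereal (c\<^sub>0 / 2) < ereal (measure lebesgue (ball x0 R \<inter> - D) / measure lebesgue (ball x0 R))"
    using assms(6) by (intro less_LiminfD less_le_trans[OF _ assms(7)[of x0]]) auto
  then have "\<forall>\<^sub>F R in at_top. 1 \<le> R \<and> c\<^sub>0 / 2 < measure lebesgue (ball x0 R \<inter> - D) / measure lebesgue (ball x0 R)"
    using eventually_ge_at_top[of 1] by eventually_elim auto
  then obtain R where R: "1 \<le> R"
    and dens: "c\<^sub>0 / 2 < measure lebesgue (ball x0 R \<inter> - D) / measure lebesgue (ball x0 R)"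
    using eventually_happens'[OF trivial_limit_at_top_linorder] by blast
  have R0: "0 < R" using R by simp
  have "measure lebesgue (ball x0 R) = w * R powr n"
    using content_ball[of R x0] R0 by (simp add: w_def n_def powr_realpow)
  then have vol: "c\<^sub>0 / 2 * (w * R powr n) \<le> measure lebesgue (ball x0 R \<inter> - D)"
    using dens w R0 by (simp add: field_simps)
  \<comment> \<open>The time scale for which the error of the time derivative is exactly \<open>m R\<^sup>-\<^sup>2\<^sup>s\<close>.\<close>
  define T where "T = (Ct * R powr (2 * s)) powr (1 / \<alpha>)"
  have T: "0 < T" using Ct R0 by (simp add: T_def)
  have T': "Ct * T powr (- \<alpha>) = R powr (- (2 * s))"
    using Ct R0 assms(3) by (simp add: T_def powr_powr powr_minus field_simps)
  obtain x t where x: "x \<in> D" "norm (x - x0) < R" and t: "\<bar>t - t0\<bar> < T" and hi: "M - m < u x t"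
    and max: "\<And>y \<tau>. u y \<tau> - m * ((norm (y - x0))\<^sup>2 / R\<^sup>2 + (\<tau> - t0)\<^sup>2 / T\<^sup>2)
        \<le> u x t - m * ((norm (x - x0))\<^sup>2 / R\<^sup>2 + (t - t0)\<^sup>2 / T\<^sup>2)"
    using penalized_maximum[OF assms(12) ub ext m(1) _ start R0 T] m by auto
  have touch1: "u y \<tau> \<le> u x t + m" for y \<tau> using ub[of y \<tau>] hi by linarith
  have touch_t: "u x \<tau> \<le> u x t + m * ((\<tau> - t0)\<^sup>2 - (t - t0)\<^sup>2) / T\<^sup>2" for \<tau>
    using max[of x \<tau>] by (simp add: algebra_simps diff_divide_distrib)
  have touch_x: "u y t \<le> u x t + m * ((norm (y - x0))\<^sup>2 - (norm (x - x0))\<^sup>2) / R\<^sup>2" for y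
    using max[of y t] by (simp add: algebra_simps diff_divide_distrib)
  define \<rho> where "\<rho> = R powr (- (2 * s))"
  have \<rho>: "0 < \<rho>" using R0 by (simp add: \<rho>_def)
  have "- (Ct * m * T powr (- \<alpha>)) \<le> time_deriv \<alpha> (u x) t"
    using m by (intro time[OF assms(10) T _ t touch1 touch_t]) auto
  then have e1: "- (m * \<rho>) \<le> time_deriv \<alpha> (u x) t"
    unfolding \<rho>_def T'[symmetric] by (simp add: mult_ac)
  have touch_p: "u y t \<le> u x t + (2 * m / R\<^sup>2) *\<^sub>R (x - x0) \<bullet> (y - x) + m / R\<^sup>2 * (norm (y - x))\<^sup>2" for y
    using touch_x[of y] unfolding recentered_paraboloid by simp
  have "laplacian (\<lambda>y. u y t) x \<le> 2 * (m / R\<^sup>2) * n"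
    unfolding n_def by (rule laplacian_touching[OF assms(8,5) x(1) touch_p])
  also have "\<dots> = 2 * n * m * R powr (- 2)" using R0 by (simp add: powr_minus_divide)
  also have "\<dots> \<le> 2 * n * m * \<rho>"
    unfolding \<rho>_def using n m R assms(2) by (intro mult_left_mono powr_mono) auto
  finally have e2: "laplacian (\<lambda>y. u y t) x \<le> 2 * n * m * \<rho>" .
  have e3: "A * ((u x t - 2 * m) * measure lebesgue (ball x0 R \<inter> - D) / (2 * R) powr q - C * m * \<rho>)
      \<le> frac_laplacian s (\<lambda>y. u y t) x"
    unfolding \<rho>_def using m hi
    by (intro frac[OF assms(9,8,5) x(1) R0 _ x(2) touch1 touch_x ext]) auto
  have "M * c1 * \<rho> = M / 2 * (c\<^sub>0 / 2 * (w * R powr n)) / (2 * R) powr q"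
  proof -
    have "R powr n / R powr q = \<rho>" by (simp add: \<rho>_def q_def powr_diff[symmetric])
    then show ?thesis using R0 by (simp add: c1_def powr_mult field_simps)
  qed
  also have "\<dots> \<le> (u x t - 2 * m) * measure lebesgue (ball x0 R \<inter> - D) / (2 * R) powr q"
    using hi m vol M w assms(6) by (intro divide_right_mono mult_mono) auto
  finally have "A * (M * c1 * \<rho> - C * m * \<rho>) \<le> frac_laplacian s (\<lambda>y. u y t) x"
    using A by (intro order_trans[OF _ e3] mult_left_mono) auto
  moreover have "time_deriv \<alpha> (u x) t + frac_laplacian s (\<lambda>y. u y t) x - laplacian (\<lambda>y. u y t) x \<le> 0"
    using pde[OF x(1)] hi m by simp
  ultimately have "A * (M * c1 * \<rho> - C * m * \<rho>) - m * \<rho> - 2 * n * m * \<rho> \<le> 0" using e1 e2 by linarith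
  moreover have "A * (M * c1 * \<rho> - C * m * \<rho>) - m * \<rho> - 2 * n * m * \<rho> = M * \<rho> * (A * c1 - \<epsilon> * L)"
    by (simp add: L_def m_def algebra_simps)
  moreover have "0 < M * \<rho> * (A * c1 - \<epsilon> * L)" using M \<rho> gap by simp
  ultimately show False by linarith
qed

end
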